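(* Let $\{x_{mn}\}$ be a double sequence in an intuitionistic fuzzy normed space $(X,\mu,\nu,\star,\circ)$. Then for all $r>0$, the set $\mathcal{I}_2^{(\mu,\nu)}\text{-}LIM_{x_{mn}}^r$ is convex.
   Context: $\mathcal{I}_2$ is a fixed non-trivial admissible ideal of subsets of $\mathbb{N}\times\mathbb{N}$ (that is, $\mathbb{N}\times\mathbb{N}\notin\mathcal{I}_2$ and every singleton belongs to $\mathcal{I}_2$). A continuous $t$-norm (resp. $t$-conorm) is an associative, commutative, continuous binary operation $\star$ (resp. $\circ$) on $[0,1]$, monotone in each argument, with $x\star 1=x$ (resp. $x\circ 0=x$) for all $x\in[0,1]$. An intuitionistic fuzzy normed space (IFNS) is a 5-tuple $(X,\mu,\nu,\star,\circ)$ where $X$ is a normed linear space, $\star$ is a continuous $t$-norm, $\circ$ is a continuous $t$-conorm, and $\mu,\nu:X\times(0,\infty)\to[0,1]$ satisfy for all $x,y\in X$, $s,t>0$: $\mu(x,t)+\nu(x,t)\le 1$; $\mu(x,t)>0$; $\mu(x,t)=1$ iff $x=0$; $\mu(\alpha x,t)=\mu(x,t/|\alpha|)$ for each scalar $\alpha\ne0$; $\mu(x,t)\star\mu(y,s)\le\mu(x+y,t+s)$; $\mu(x,\cdot)$ is continuous on $(0,\infty)$; $\lim_{t\to\infty}\mu(x,t)=1$, and $\lim_{t\to0}\mu(x,t)=0$ for $x\neq 0$; $\nu(x,t)<1$; $\nu(x,t)=0$ iff $x=0$; $\nu(\alpha x,t)=\nu(x,t/|\alpha|)$ for each scalar $\alpha\neq0$;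 $\nu(x,t)\circ\nu(y,s)\ge\nu(x+y,s+t)$; $\nu(x,\cdot)$ is continuous on $(0,\infty)$; $\lim_{t\to\infty}\nu(x,t)=0$, and $\lim_{t\to0}\nu(x,t)=1$ for $x\ne0$. For $r\ge0$, $\{x_{mn}\}$ is rough $\mathcal{I}_2$-convergent to $\xi\in X$ if for every $\varepsilon>0$ and $\lambda\in(0,1)$, $\{(m,n)\in\mathbb{N}\times\mathbb{N}:\mu(x_{mn}-\xi,r+\varepsilon)\le1-\lambda\text{ or }\nu(x_{mn}-\xi,r+\varepsilon)\ge\lambda\}\in\mathcal{I}_2$. $\mathcal{I}_2^{(\mu,\nu)}\text{-}LIM_{x_{mn}}^r$ is the set of all such $\xi\in X$. *)

theory Defs
  imports "HOL-Analysis.Analysis"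
begin

definition set_ideal :: "'i set set \<Rightarrow> bool" where
  "set_ideal I \<longleftrightarrow>
     {} \<in> I \<and>
     (\<forall>A B. A \<in> I \<and> B \<in> I \<longrightarrow> A \<union> B \<in> I) \<and>
     (\<forall>A B. A \<in> I \<and> B \<subseteq> A \<longrightarrow> B \<in> I)"

definition nontrivial_admissible_ideal :: "'i set set \<Rightarrow> bool" where
  "nontrivial_admissible_ideal I \<longleftrightarrow> set_ideal I \<and> UNIV \<notin> I \<and> (\<forall>p. {p} \<in> I)"

text \<open>Operations on \<open>[0,1]\<close> are total functions on the reals of which only the restriction to
  the unit square matters; continuity is joint.\<close>

locale continuous_unit_op =
  fixes f :: "real \<Rightarrow> real \<Rightarrow> real"
  assumes closed: "\<lbrakk>a \<in> {0..1}; b \<in> {0..1}\<rbrakk> \<Longrightarrow> f a b \<in> {0..1}"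
    and assoc: "\<lbrakk>a \<in> {0..1}; b \<in> {0..1}; c \<in> {0..1}\<rbrakk> \<Longrightarrow> f (f a b) c = f a (f b c)"
    and commute: "\<lbrakk>a \<in> {0..1}; b \<in> {0..1}\<rbrakk> \<Longrightarrow> f a b = f b a"
    and continuous: "continuous_on ({0..1} \<times> {0..1}) (\<lambda>(a, b). f a b)"
    and mono_left: "\<lbrakk>a \<in> {0..1}; b \<in> {0..1}; c \<in> {0..1}; a \<le> b\<rbrakk> \<Longrightarrow> f a c \<le> f b c"
    and mono_right: "\<lbrakk>a \<in> {0..1}; b \<in> {0..1}; c \<in> {0..1}; a \<le> b\<rbrakk> \<Longrightarrow> f c a \<le> f c b"

locale continuous_t_norm = continuous_unit_op f for f :: "real \<Rightarrow> real \<Rightarrow> real" +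
  assumes right_unit: "a \<in> {0..1} \<Longrightarrow> f a 1 = a"

locale continuous_t_conorm = continuous_unit_op f for f :: "real \<Rightarrow> real \<Rightarrow> real" +
  assumes right_unit: "a \<in> {0..1} \<Longrightarrow> f a 0 = a"

text \<open>The membership functions are defined on \<open>X \<times> (0,\<infinity>)\<close>; values at non-positive second
  argument are left unconstrained. The space \<open>X\<close> is the whole type.\<close>

locale ifns =
  star: continuous_t_norm star + circ: continuous_t_conorm circ
  for star :: "real \<Rightarrow> real \<Rightarrow> real" and circ :: "real \<Rightarrow> real \<Rightarrow> real" +
  fixes \<mu> \<nu> :: "'a::real_normed_vector \<Rightarrow> real \<Rightarrow> real"
  assumes mu_range: "t > 0 \<Longrightarrow> \<mu> x t \<in> {0..1}"
    and nu_range: "t > 0 \<Longrightarrow> \<nu> x t \<in> {0..1}"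
    and mu_nu_le: "t > 0 \<Longrightarrow> \<mu> x t + \<nu> x t \<le> 1"
    and mu_pos: "t > 0 \<Longrightarrow> \<mu> x t > 0"
    and mu_eq_1_iff: "t > 0 \<Longrightarrow> \<mu> x t = 1 \<longleftrightarrow> x = 0"
    and mu_scale: "\<lbrakk>t > 0; \<alpha> \<noteq> 0\<rbrakk> \<Longrightarrow> \<mu> (\<alpha> *\<^sub>R x) t = \<mu> x (t / \<bar>\<alpha>\<bar>)"
    and mu_triangle: "\<lbrakk>t > 0; s > 0\<rbrakk> \<Longrightarrow> star (\<mu> x t) (\<mu> y s) \<le> \<mu> (x + y) (t + s)"
    and mu_continuous: "continuous_on {0<..} (\<mu> x)"
    and mu_at_top: "(\<mu> x \<longlongrightarrow> 1) at_top"
    and mu_at_0: "x \<noteq> 0 \<Longrightarrow> (\<mu> x \<longlongrightarrow> 0) (at_right 0)"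
    and nu_less_1: "t > 0 \<Longrightarrow> \<nu> x t < 1"
    and nu_eq_0_iff: "t > 0 \<Longrightarrow> \<nu> x t = 0 \<longleftrightarrow> x = 0"
    and nu_scale: "\<lbrakk>t > 0; \<alpha> \<noteq> 0\<rbrakk> \<Longrightarrow> \<nu> (\<alpha> *\<^sub>R x) t = \<nu> x (t / \<bar>\<alpha>\<bar>)"
    and nu_triangle: "\<lbrakk>t > 0; s > 0\<rbrakk> \<Longrightarrow> circ (\<nu> x t) (\<nu> y s) \<ge> \<nu> (x + y) (s + t)"
    and nu_continuous: "continuous_on {0<..} (\<nu> x)"
    and nu_at_top: "(\<nu> x \<longlongrightarrow> 0) at_top"
    and nu_at_0: "x \<noteq> 0 \<Longrightarrow> (\<nu> x \<longlongrightarrow> 1) (at_right 0)"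

definition rough_I2_convergent ::
  "(nat \<times> nat) set set \<Rightarrow> ('a::real_normed_vector \<Rightarrow> real \<Rightarrow> real) \<Rightarrow> ('a \<Rightarrow> real \<Rightarrow> real)
     \<Rightarrow> real \<Rightarrow> (nat \<Rightarrow> nat \<Rightarrow> 'a) \<Rightarrow> 'a \<Rightarrow> bool" where
  "rough_I2_convergent I \<mu> \<nu> r x \<xi> \<longleftrightarrow>
     (\<forall>\<epsilon>>0. \<forall>l\<in>{0<..<1}.
        {(m, n). \<mu> (x m n - \<xi>) (r + \<epsilon>) \<le> 1 - l \<or> \<nu> (x m n - \<xi>) (r + \<epsilon>) \<ge> l} \<in> I)"

definition rough_I2_LIM ::
  "(nat \<times> nat) set set \<Rightarrow> ('a::real_normed_vector \<Rightarrow> real \<Rightarrow> real) \<Rightarrow> ('a \<Rightarrow> real \<Rightarrow> real)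
     \<Rightarrow> real \<Rightarrow> (nat \<Rightarrow> nat \<Rightarrow> 'a) \<Rightarrow> 'a set" where
  "rough_I2_LIM I \<mu> \<nu> r x = {\<xi>. rough_I2_convergent I \<mu> \<nu> r x \<xi>}"

end

(* With weights u + v = 1, the scaling axiom lets u(z - a) and v(z - b) split the radius r + e as
   u(r + e) + v(r + e), so the triangle axioms bound the degrees at the convex combination by the
   star- and circ-combinations of the degrees at a and b, all at the same radius r + e. Continuity
   of the two operations at their units then turns a level l for the combination into a common
   level s for a and b, and the exceptional set lies in the union of two members of the ideal. *)

theory Submission
  imports Defs
begin

text \<open>Both points of a convex combination will share one level, so only the diagonal matters
  and joint continuity reduces to one real variable.\<close>

lemma (in continuous_unit_op) continuous_on_diagonal: "continuous_on {0..1} (\<lambda>s. f s s)"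
proof -
  have "continuous_on {0..1} ((\<lambda>(a, b). f a b) \<circ> (\<lambda>s. (s, s)))"
    by (intro continuous_on_compose continuous_intros continuous_on_subset[OF continuous]) auto
  then show ?thesis
    by (simp add: o_def)
qed

context ifns
begin

text \<open>As \<open>s\<close> decreases to 0, \<open>star (1 - s) (1 - s)\<close> tends to
  \<open>star 1 1 = 1\<close> and \<open>circ s s\<close> to \<open>circ 0 0 = 0\<close>. Each
  strict bound thus holds for all small \<open>s > 0\<close>, and one \<open>s\<close> serves
  both.\<close>

lemma exists_level:
  assumes "0 < l"
  obtains s where "0 < s" "s < 1" "1 - l < star (1 - s) (1 - s)" "circ s s < l"
proof -
  have "continuous_on {0..1} ((\<lambda>t. star t t) \<circ> (\<lambda>s. 1 - s))"
    by (intro continuous_on_compose continuous_intros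
        continuous_on_subset[OF star.continuous_on_diagonal]) auto
  \<comment> \<open>Since 0 is the left endpoint of the unit interval, continuity there is exactly a
    limit along \<open>at_right 0\<close>.\<close>
  then have "((\<lambda>s. star (1 - s) (1 - s)) \<longlongrightarrow> star 1 1) (at_right 0)"
    by (auto simp: continuous_on_def o_def at_within_Icc_at_right dest!: bspec[where x = 0])
  then have star: "\<forall>\<^sub>F s in at_right 0. 1 - l < star (1 - s) (1 - s)"
    by (rule order_tendstoD) (use assms in \<open>simp add: star.right_unit\<close>)
  have "((\<lambda>s. circ s s) \<longlongrightarrow> circ 0 0) (at_right 0)"
    using circ.continuous_on_diagonal
    by (auto simp: continuous_on_def at_within_Icc_at_right dest!: bspec[where x = 0])
  then have circ: "\<forall>\<^sub>F s in at_right 0. circ s s < l"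
    by (rule order_tendstoD) (use assms in \<open>simp add: circ.right_unit\<close>)
  have "\<forall>\<^sub>F s in at_right (0::real). s \<in> {0<..<1}"
    by (rule eventually_at_right_real) simp
  with star circ have "\<forall>\<^sub>F s in at_right 0.
      0 < s \<and> s < 1 \<and> 1 - l < star (1 - s) (1 - s) \<and> circ s s < l"
    by eventually_elim auto
  then show thesis
    using that eventually_happens'[OF trivial_limit_at_right_real] by blast
qed

text \<open>By scaling, \<open>u *\<^sub>R y\<close> at \<open>u * t\<close> has the same degrees as
  \<open>y\<close> at \<open>t\<close>. Strict positivity of the weights keeps the scalars nonzero
  and both parts of \<open>t\<close> positive.\<close>

lemma convex_combination_bounds:
  assumes "0 < u" "0 < v" "u + v = 1" "0 < t"
  shows "star (\<mu> y t) (\<mu> z t) \<le> \<mu> (u *\<^sub>R y + v *\<^sub>R z) t"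
    and "\<nu> (u *\<^sub>R y + v *\<^sub>R z) t \<le> circ (\<nu> y t) (\<nu> z t)"
proof -
  \<comment> \<open>Both orders occur: \<open>nu_triangle\<close> adds the radii in the reverse of
    the order used by \<open>mu_triangle\<close>.\<close>
  have t: "u * t + v * t = t" "v * t + u * t = t"
    using assms(3) by (simp_all flip: distrib_right add: add.commute)
  show "star (\<mu> y t) (\<mu> z t) \<le> \<mu> (u *\<^sub>R y + v *\<^sub>R z) t"
    using mu_triangle[of "u * t" "v * t" "u *\<^sub>R y" "v *\<^sub>R z"] assms t by (simp add: mu_scale)
  show "\<nu> (u *\<^sub>R y + v *\<^sub>R z) t \<le> circ (\<nu> y t) (\<nu> z t)"
    using nu_triangle[of "u * t" "v * t" "u *\<^sub>R y" "v *\<^sub>R z"] assms t by (simp add: nu_scale)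
qed

lemma rough_I2_convergent_convex_combination:
  assumes I: "set_ideal I" and "0 \<le> r"
    and a: "rough_I2_convergent I \<mu> \<nu> r x a" and b: "rough_I2_convergent I \<mu> \<nu> r x b"
    and uv: "0 < u" "0 < v" "u + v = 1"
  shows "rough_I2_convergent I \<mu> \<nu> r x (u *\<^sub>R a + v *\<^sub>R b)"
  unfolding rough_I2_convergent_def
proof (intro allI impI ballI)
  fix e l :: real
  assume "0 < e" and l: "l \<in> {0<..<1}"
  define t where "t = r + e"
  have t: "0 < t"
    using \<open>0 \<le> r\<close> \<open>0 < e\<close> by (simp add: t_def)
  obtain s where s: "0 < s" "s < 1" "1 - l < star (1 - s) (1 - s)" "circ s s < l"
    using exists_level l by auto
  define B where "B c = {(m, n). \<mu> (x m n - c) t \<le> 1 - s \<or> \<nu> (x m n - c) t \<ge> s}" for c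
  have "B a \<in> I" "B b \<in> I"
    using a b \<open>0 < e\<close> s by (simp_all add: rough_I2_convergent_def B_def t_def)
  then have "B a \<union> B b \<in> I"
    using I by (simp add: set_ideal_def)
  moreover have "{(m, n). \<mu> (x m n - (u *\<^sub>R a + v *\<^sub>R b)) t \<le> 1 - l \<or>
      \<nu> (x m n - (u *\<^sub>R a + v *\<^sub>R b)) t \<ge> l} \<subseteq> B a \<union> B b"
  \<comment> \<open>An index outside both exceptional sets has all four degrees strictly within
    level \<open>s\<close>; the choice of \<open>s\<close> then rules out a violation of level
    \<open>l\<close>.\<close>
  proof (rule subrelI, rule ccontr)
    fix m n
    assume notin: "(m, n) \<notin> B a \<union> B b"
      and bad: "(m, n) \<in> {(m, n). \<mu> (x m n - (u *\<^sub>R a + v *\<^sub>R b)) t \<le> 1 - l \<or>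
        \<nu> (x m n - (u *\<^sub>R a + v *\<^sub>R b)) t \<ge> l}"
    define y z where "y = x m n - a" and "z = x m n - b"
    \<comment> \<open>As \<open>u + v = 1\<close>, the term \<open>x m n\<close> is a convex
      combination of itself.\<close>
    have "u *\<^sub>R y + v *\<^sub>R z = (u + v) *\<^sub>R x m n - (u *\<^sub>R a + v *\<^sub>R b)"
      by (simp add: y_def z_def algebra_simps)
    then have comb: "x m n - (u *\<^sub>R a + v *\<^sub>R b) = u *\<^sub>R y + v *\<^sub>R z"
      using uv by simp
    have good: "1 - s < \<mu> y t" "1 - s < \<mu> z t" "\<nu> y t < s" "\<nu> z t < s"
      using notin by (auto simp: B_def y_def z_def)
    have range: "\<mu> y t \<in> {0..1}" "\<mu> z t \<in> {0..1}" "\<nu> y t \<in> {0..1}" "\<nu> z t \<in> {0..1}"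
        "1 - s \<in> {0..1}" "s \<in> {0..1}"
      using mu_range[OF t] nu_range[OF t] s by auto
    \<comment> \<open>Monotonicity gives only weak inequalities; the strict one comes from the
      choice of \<open>s\<close>.\<close>
    have "star (1 - s) (1 - s) \<le> star (\<mu> y t) (1 - s)"
      using star.mono_left range good by simp
    also have "\<dots> \<le> star (\<mu> y t) (\<mu> z t)"
      using star.mono_right range good by simp
    also have "\<dots> \<le> \<mu> (u *\<^sub>R y + v *\<^sub>R z) t"
      by (rule convex_combination_bounds[OF uv t])
    finally have "1 - l < \<mu> (u *\<^sub>R y + v *\<^sub>R z) t"
      using s by simp
    moreover have "\<nu> (u *\<^sub>R y + v *\<^sub>R z) t < l"
    proof -
      have "\<nu> (u *\<^sub>R y + v *\<^sub>R z) t \<le> circ (\<nu> y t) (\<nu> z t)"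
        by (rule convex_combination_bounds[OF uv t])
      also have "\<dots> \<le> circ s (\<nu> z t)"
        using circ.mono_left range good by simp
      also have "\<dots> \<le> circ s s"
        using circ.mono_right range good by simp
      finally show ?thesis
        using s by simp
    qed
    ultimately show False
      using bad comb by simp
  qed
  ultimately show "{(m, n). \<mu> (x m n - (u *\<^sub>R a + v *\<^sub>R b)) (r + e) \<le> 1 - l \<or>
      \<nu> (x m n - (u *\<^sub>R a + v *\<^sub>R b)) (r + e) \<ge> l} \<in> I"
    using I unfolding set_ideal_def t_def by blast
qed

lemma convex_rough_I2_LIM:
  assumes "set_ideal I" "0 \<le> r"
  shows "convex (rough_I2_LIM I \<mu> \<nu> r x)"
  unfolding convex_def rough_I2_LIM_def
proof (intro ballI allI impI)
  fix a b and u v :: real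
  assume "a \<in> {\<xi>. rough_I2_convergent I \<mu> \<nu> r x \<xi>}" "b \<in> {\<xi>. rough_I2_convergent I \<mu> \<nu> r x \<xi>}"
    and "0 \<le> u" "0 \<le> v" "u + v = 1"
  then show "u *\<^sub>R a + v *\<^sub>R b \<in> {\<xi>. rough_I2_convergent I \<mu> \<nu> r x \<xi>}"
    using rough_I2_convergent_convex_combination[OF assms, of x a b u v]
    \<comment> \<open>If one weight vanishes, the other is 1 and the combination is \<open>a\<close>
      or \<open>b\<close> itself; both cannot vanish.\<close>
    by (cases "u = 0"; cases "v = 0") auto
qed

end

theorem theorem3p4:
  fixes I2 :: "(nat \<times> nat) set set"
    and star circ :: "real \<Rightarrow> real \<Rightarrow> real"
    and \<mu> \<nu> :: "'a::real_normed_vector \<Rightarrow> real \<Rightarrow> real"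
    and x :: "nat \<Rightarrow> nat \<Rightarrow> 'a"
  assumes "nontrivial_admissible_ideal I2"
    and "ifns star circ \<mu> \<nu>"
  shows "\<forall>r>0. convex (rough_I2_LIM I2 \<mu> \<nu> r x)"
proof -
  interpret ifns star circ \<mu> \<nu>
    by fact
  show ?thesis
    using assms(1) by (simp add: convex_rough_I2_LIM nontrivial_admissible_ideal_def)
qed

end
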